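(* Let $B$ be a complex Banach space and let $e^{t\mathbf{A}}$, $t\ge0$, be a $C_0$-semigroup of type $(M,\omega)$ on $B$ with generator $\mathbf{A}$. If $e^{t\mathbf{A}}$ has an analytic extension $e^{z\mathbf{A}}$ to the open sector $S_\theta=\{z\in\mathbb{C}\mid z\ne0,\ |\arg z|<\theta\}$ for some $\theta>0$, then $e^{z\mathbf{A}}$ is injective for every $z\in S_\theta$.
   Context: A $C_0$-semigroup $e^{t\mathbf{A}}\in\mathbb{B}(B)$ is of type $(M,\omega)$, with $M\ge1$ and $\omega\ge0$, if $\|e^{t\mathbf{A}}\|_{\mathbb{B}(B)}\le Me^{\omega t}$ for $0\le t<\infty$. Its generator is $\mathbf{A}x=\lim_{t\to0^+}\frac1t(e^{t\mathbf{A}}x-x)$, with domain $D(\mathbf{A})$ consisting of the $x\in B$ for which the limit exists. An analytic extension to $S_\theta$ is an analytic map $z\mapsto e^{z\mathbf{A}}$ from $S_\theta$ to $\mathbb{B}(B)$ that coincides with the given semigroup for $z=t>0$ (an analytic semigroup defined in $S_\theta$). *)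

theory Defs
  imports "HOL-Analysis.Analysis"
begin

text \<open>
  Complex Banach spaces: a real Banach space whose real scalar multiplication and norm
  come from a complex one.
\<close>

class complex_banach = banach +
  fixes scaleC :: "complex \<Rightarrow> 'a \<Rightarrow> 'a" (infixr "*\<^sub>C" 75)
  assumes scaleC_add_right: "a *\<^sub>C (x + y) = a *\<^sub>C x + a *\<^sub>C y"
    and scaleC_add_left: "(a + b) *\<^sub>C x = a *\<^sub>C x + b *\<^sub>C x"
    and scaleC_scaleC: "a *\<^sub>C b *\<^sub>C x = (a * b) *\<^sub>C x"
    and scaleC_one: "1 *\<^sub>C x = x"
    and scaleR_scaleC: "r *\<^sub>R x = complex_of_real r *\<^sub>C x"
    and norm_scaleC: "norm (a *\<^sub>C x) = norm a * norm x"

instantiation complex :: complex_banach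
begin

definition scaleC_complex :: "complex \<Rightarrow> complex \<Rightarrow> complex"
  where "scaleC_complex a x = a * x"

instance
  by standard (simp_all add: scaleC_complex_def algebra_simps norm_mult scaleR_conv_of_real)

end

lemma bounded_linear_scaleC: "bounded_linear ((*\<^sub>C) a :: 'a::complex_banach \<Rightarrow> 'a)"
proof (rule bounded_linear_intro[where K = "norm a"])
  show "a *\<^sub>C (x + y) = a *\<^sub>C x + a *\<^sub>C y" for x y :: 'a
    by (rule scaleC_add_right)
  show "a *\<^sub>C (r *\<^sub>R x) = r *\<^sub>R (a *\<^sub>C x)" for r and x :: 'a
    by (simp add: scaleR_scaleC scaleC_scaleC mult.commute)
  show "norm (a *\<^sub>C x) \<le> norm x * norm a" for x :: 'a
    by (simp add: norm_scaleC mult.commute)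
qed

text \<open>
  \<^typ>\<open>'a \<Rightarrow>\<^sub>L 'b\<close> consists of the bounded real-linear maps; the complex-linear ones are
  singled out by \<open>complex_linear\<close> below. Operators are scaled through the codomain.
\<close>

instantiation blinfun :: (real_normed_vector, complex_banach) complex_banach
begin

lift_definition scaleC_blinfun :: "complex \<Rightarrow> ('a \<Rightarrow>\<^sub>L 'b) \<Rightarrow> ('a \<Rightarrow>\<^sub>L 'b)"
  is "\<lambda>a f x. a *\<^sub>C f x"
  by (rule bounded_linear_compose[OF bounded_linear_scaleC])

instance
proof
  fix a b :: complex and r :: real and f g :: "'a \<Rightarrow>\<^sub>L 'b"
  show "a *\<^sub>C (f + g) = a *\<^sub>C f + a *\<^sub>C g"
    by transfer (simp add: scaleC_add_right)
  show "(a + b) *\<^sub>C f = a *\<^sub>C f + b *\<^sub>C f"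
    by transfer (simp add: scaleC_add_left)
  show "a *\<^sub>C b *\<^sub>C f = (a * b) *\<^sub>C f"
    by transfer (simp add: scaleC_scaleC)
  show one: "1 *\<^sub>C f = f"
    by transfer (simp add: scaleC_one)
  show "r *\<^sub>R f = complex_of_real r *\<^sub>C f"
    by transfer (simp add: scaleR_scaleC)
  have le: "norm (c *\<^sub>C h) \<le> norm c * norm h" for c and h :: "'a \<Rightarrow>\<^sub>L 'b"
  proof (rule norm_blinfun_bound)
    show "norm (blinfun_apply (c *\<^sub>C h) x) \<le> norm c * norm h * norm x" for x
      using mult_left_mono[OF norm_blinfun[of h x], of "norm c"]
      by (simp add: scaleC_blinfun.rep_eq norm_scaleC mult.assoc)
  qed simp
  show "norm (a *\<^sub>C f) = norm a * norm f"
  proof (cases "a = 0")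
    case True
    then show ?thesis using le[of a f] by simp
  next
    case False
    have "inverse a *\<^sub>C a *\<^sub>C f = f"
      using False one by transfer (simp add: scaleC_scaleC)
    then have "norm f \<le> norm (inverse a) * norm (a *\<^sub>C f)"
      using le[of "inverse a" "a *\<^sub>C f"] by simp
    then have "norm a * norm f \<le> norm (a *\<^sub>C f)"
      using False mult_left_mono[of "norm f" "norm (inverse a) * norm (a *\<^sub>C f)" "norm a"]
      by (simp add: norm_inverse mult.assoc[symmetric] del: inverse_eq_divide)
    with le[of a f] show ?thesis by simp
  qed
qed

end

definition complex_linear :: "('a::complex_banach \<Rightarrow>\<^sub>L 'b::complex_banach) \<Rightarrow> bool"
  where "complex_linear f \<longleftrightarrow> (\<forall>a x. blinfun_apply f (a *\<^sub>C x) = a *\<^sub>C blinfun_apply f x)"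

text \<open>Only the values at \<open>t \<ge> 0\<close> matter.\<close>

definition C0_semigroup :: "(real \<Rightarrow> ('a::complex_banach \<Rightarrow>\<^sub>L 'a)) \<Rightarrow> bool"
  where "C0_semigroup T \<longleftrightarrow>
    (\<forall>t\<ge>0. complex_linear (T t)) \<and>
    T 0 = id_blinfun \<and>
    (\<forall>s\<ge>0. \<forall>t\<ge>0. T (s + t) = T s o\<^sub>L T t) \<and>
    (\<forall>x. ((\<lambda>t. blinfun_apply (T t) x) \<longlongrightarrow> x) (at_right 0))"

definition semigroup_of_type ::
    "real \<Rightarrow> real \<Rightarrow> (real \<Rightarrow> ('a::complex_banach \<Rightarrow>\<^sub>L 'a)) \<Rightarrow> bool"
  where "semigroup_of_type M \<omega> T \<longleftrightarrow>
    M \<ge> 1 \<and> \<omega> \<ge> 0 \<and> (\<forall>t\<ge>0. norm (T t) \<le> M * exp (\<omega> * t))"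

text \<open>
  The generator is a partially defined operator, given by its domain \<open>D\<close> and a total
  function \<open>A\<close> that is only constrained on \<open>D\<close>.
\<close>

definition is_generator ::
    "'a set \<Rightarrow> ('a \<Rightarrow> 'a) \<Rightarrow> (real \<Rightarrow> ('a::complex_banach \<Rightarrow>\<^sub>L 'a)) \<Rightarrow> bool"
  where "is_generator D A T \<longleftrightarrow>
    D = {x. \<exists>y. ((\<lambda>t. (1 / t) *\<^sub>R (blinfun_apply (T t) x - x)) \<longlongrightarrow> y) (at_right 0)} \<and>
    (\<forall>x\<in>D. ((\<lambda>t. (1 / t) *\<^sub>R (blinfun_apply (T t) x - x)) \<longlongrightarrow> A x) (at_right 0))"

text \<open>\<^const>\<open>Arg\<close> takes values in \<open>(-\<pi>, \<pi>]\<close>, so the sector is open for every \<open>\<theta> > 0\<close>.\<close>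

definition sector :: "real \<Rightarrow> complex set"
  where "sector \<theta> = {z. z \<noteq> 0 \<and> \<bar>Arg z\<bar> < \<theta>}"

text \<open>
  Complex differentiability in norm near each point, as in \<^const>\<open>analytic_on\<close>. For
  operator-valued functions the norm is the operator norm.
\<close>

definition banach_analytic_on :: "(complex \<Rightarrow> 'b::complex_banach) \<Rightarrow> complex set \<Rightarrow> bool"
  where "banach_analytic_on f S \<longleftrightarrow>
    (\<forall>z\<in>S. \<exists>e>0. \<forall>w\<in>ball z e. \<exists>f'. (f has_derivative (\<lambda>h. h *\<^sub>C f')) (at w))"

definition analytic_extension ::
    "real \<Rightarrow> (real \<Rightarrow> ('a::complex_banach \<Rightarrow>\<^sub>L 'a)) \<Rightarrow> (complex \<Rightarrow> ('a \<Rightarrow>\<^sub>L 'a)) \<Rightarrow> bool"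
  where "analytic_extension \<theta> T E \<longleftrightarrow>
    (\<forall>z\<in>sector \<theta>. complex_linear (E z)) \<and>
    banach_analytic_on E (sector \<theta>) \<and>
    (\<forall>t>0. E (complex_of_real t) = T t)"

end

theory Submission
  imports Defs "HOL-Complex_Analysis.Conformal_Mappings"
begin

text \<open>
  Suppose \<open>e\<^bsup>zA\<^esup> x = 0\<close> with \<open>x \<noteq> 0\<close>, and let \<open>\<phi>\<close> be a bounded linear functional with
  \<open>\<phi> x \<noteq> 0\<close>. By the identity theorem, applied near an arc that joins \<open>z\<close> to \<open>\<bar>z\<bar>\<close> in the
  sector, \<open>\<phi> (e\<^bsup>(z+t)A\<^esup> x) = \<phi> (e\<^bsup>tA\<^esup> e\<^bsup>zA\<^esup> x) = 0\<close> for all small \<open>t > 0\<close>. By the identity theorem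
  on the whole sector, \<open>\<phi> (e\<^bsup>wA\<^esup> x) = 0\<close> for all \<open>w\<close>, and letting \<open>w \<rightarrow> 0\<close> along the positive reals
  gives \<open>\<phi> x = 0\<close>. The functional comes from the observation that a minimal sublinear
  functional is linear.
\<close>

section \<open>Separation of points by functionals\<close>

definition sublinear :: "('a::real_vector \<Rightarrow> real) \<Rightarrow> bool"
  where "sublinear p \<longleftrightarrow>
    (\<forall>x y. p (x + y) \<le> p x + p y) \<and> (\<forall>c\<ge>0. \<forall>x. p (c *\<^sub>R x) \<le> c * p x)"

lemma sublinear_add: "sublinear p \<Longrightarrow> p (x + y) \<le> p x + p y"
  by (simp add: sublinear_def)

lemma sublinear_scaleR_le: "sublinear p \<Longrightarrow> 0 \<le> c \<Longrightarrow> p (c *\<^sub>R x) \<le> c * p x"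
  by (simp add: sublinear_def)

lemma sublinear_zero:
  assumes "sublinear p" shows "p 0 = 0"
  using sublinear_add[OF assms, of 0 0] sublinear_scaleR_le[OF assms, of 0 0] by simp

text \<open>The definition asks for homogeneity only as an inequality, which is easier to verify for
  infima; the reverse inequality is the same one for the factor \<open>1 / c\<close> at
  \<open>c *\<^sub>R x\<close>.\<close>

lemma sublinear_scaleR:
  assumes p: "sublinear p" and c: "0 \<le> c" shows "p (c *\<^sub>R x) = c * p x"
proof (cases "c = 0")
  case True
  then show ?thesis using sublinear_zero[OF p] by simp
next
  case False
  with c have "p x \<le> (1 / c) * p (c *\<^sub>R x)"
    using sublinear_scaleR_le[OF p, of "1 / c" "c *\<^sub>R x"] by simp
  then have "c * p x \<le> p (c *\<^sub>R x)" using False c by (simp add: field_simps)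
  with sublinear_scaleR_le[OF p c, of x] show ?thesis by simp
qed

lemma sublinear_minus: "sublinear p \<Longrightarrow> - p (- x) \<le> p x"
  using sublinear_add[of p x "- x"] sublinear_zero[of p] by simp

lemma sublinear_norm: "sublinear (norm :: 'a::real_normed_vector \<Rightarrow> real)"
  by (simp add: sublinear_def norm_triangle_ineq)

text \<open>
  A sublinear functional below \<open>p\<close> that is at most \<open>- p x\<close> at \<open>- x\<close>; a minimal \<open>p\<close> equals
  all its tilts and is therefore odd.
\<close>

definition tilt :: "('a::real_vector \<Rightarrow> real) \<Rightarrow> 'a \<Rightarrow> 'a \<Rightarrow> real"
  where "tilt p x y = (INF t\<in>{0..}. p (y + t *\<^sub>R x) - t * p x)"

lemma tilt_le:
  assumes p: "sublinear p" and "0 \<le> t" shows "tilt p x y \<le> p (y + t *\<^sub>R x) - t * p x"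
  unfolding tilt_def
proof (rule cINF_lower)
  show "bdd_below ((\<lambda>t. p (y + t *\<^sub>R x) - t * p x) ` {0..})"
  proof (rule bdd_belowI2)
    fix t :: real assume "t \<in> {0..}"
    \<comment> \<open>A bound independent of \<open>t\<close>: write \<open>t *\<^sub>R x\<close> as
      \<open>(y + t *\<^sub>R x) + (- y)\<close> and use subadditivity.\<close>
    then show "- p (- y) \<le> p (y + t *\<^sub>R x) - t * p x"
      using sublinear_add[OF p, of "y + t *\<^sub>R x" "- y"] sublinear_scaleR[OF p, of t x]
      by (simp add: algebra_simps)
  qed
qed (use assms in simp)

lemma le_tiltI:
  assumes "\<And>t. 0 \<le> t \<Longrightarrow> c \<le> p (y + t *\<^sub>R x) - t * p x" shows "c \<le> tilt p x y"
  unfolding tilt_def by (rule cINF_greatest) (use assms in auto)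

lemma tilt_le_self: "sublinear p \<Longrightarrow> tilt p x y \<le> p y"
  using tilt_le[of p 0 x y] by simp

lemma tilt_minus_le: "sublinear p \<Longrightarrow> tilt p x (- x) \<le> - p x"
  using tilt_le[of p 1 x "- x"] sublinear_zero[of p] by simp

text \<open>Parameters \<open>s\<close> for \<open>a\<close> and \<open>t\<close> for
  \<open>b\<close> add up to an admissible parameter \<open>s + t\<close> for \<open>a + b\<close>,
  and the two infima are then taken one after the other. For homogeneity the parameter
  \<open>t\<close> is rescaled to \<open>c * t\<close>.\<close>

lemma sublinear_tilt:
  assumes p: "sublinear p" shows "sublinear (tilt p x)"
  unfolding sublinear_def
proof (intro conjI allI impI)
  fix a b
  have *: "tilt p x (a + b) \<le> (p (a + s *\<^sub>R x) - s * p x) + (p (b + t *\<^sub>R x) - t * p x)"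
    if "0 \<le> s" "0 \<le> t" for s t
    using tilt_le[OF p, of "s + t" x "a + b"] that
      sublinear_add[OF p, of "a + s *\<^sub>R x" "b + t *\<^sub>R x"]
    by (simp add: algebra_simps)
  have "tilt p x (a + b) - (p (a + s *\<^sub>R x) - s * p x) \<le> tilt p x b" if "0 \<le> s" for s
    by (rule le_tiltI) (use *[OF that] in \<open>simp add: algebra_simps\<close>)
  then have "tilt p x (a + b) - tilt p x b \<le> tilt p x a"
    by (intro le_tiltI) (simp add: algebra_simps)
  then show "tilt p x (a + b) \<le> tilt p x a + tilt p x b" by simp
next
  fix c :: real and y assume c: "0 \<le> c"
  show "tilt p x (c *\<^sub>R y) \<le> c * tilt p x y"
  proof (cases "c = 0")
    case True
    then show ?thesis using tilt_le_self[OF p, of x 0] sublinear_zero[OF p] by simp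
  next
    case False
    have "tilt p x (c *\<^sub>R y) / c \<le> p (y + t *\<^sub>R x) - t * p x" if "0 \<le> t" for t
    proof -
      have "tilt p x (c *\<^sub>R y) \<le> p (c *\<^sub>R (y + t *\<^sub>R x)) - (c * t) * p x"
        using tilt_le[OF p, of "c * t" x "c *\<^sub>R y"] that c by (simp add: scaleR_add_right)
      also have "\<dots> = c * (p (y + t *\<^sub>R x) - t * p x)"
        by (simp only: sublinear_scaleR[OF p c]) (simp add: algebra_simps)
      finally show ?thesis using c False by (simp add: field_simps)
    qed
    then have "tilt p x (c *\<^sub>R y) / c \<le> tilt p x y" by (rule le_tiltI)
    then show ?thesis using c False by (simp add: field_simps)
  qed
qed

section \<open>Existence and linearity of minimal sublinear functionals\<close>

lemma exists_minimal_sublinear: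
  assumes p: "sublinear p"
  obtains q where "sublinear q" "q \<le> p" "\<And>r. sublinear r \<Longrightarrow> r \<le> q \<Longrightarrow> r = q"
proof -
  define A where "A = {q. sublinear q \<and> q \<le> p}"
  have "\<exists>m\<in>A. \<forall>a\<in>A. a \<le> m \<longrightarrow> a = m"
  \<comment> \<open>Zorn's lemma yields maximal elements, so the pointwise order is reversed and
    chains need lower bounds.\<close>
  proof (rule predicate_Zorn[where P = "\<lambda>f g. g \<le> f"])
    show "partial_order_on A (relation_of (\<lambda>f g. g \<le> f) A)"
      by (rule partial_order_on_relation_ofI) auto
    fix C assume C: "C \<in> Chains (relation_of (\<lambda>f g. g \<le> f) A)"
    then have CA: "C \<subseteq> A" and tot: "\<And>q r. q \<in> C \<Longrightarrow> r \<in> C \<Longrightarrow> q \<le> r \<or> r \<le> q"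
      unfolding Chains_def relation_of_def by auto
    show "\<exists>u\<in>A. \<forall>a\<in>C. u \<le> a"
    proof (cases "C = {}")
      case True
      then show ?thesis using p by (auto simp: A_def)
    next
      case False
      \<comment> \<open>The pointwise infimum of a nonempty chain is its lower bound; it is finite
        because each member satisfies \<open>r y \<ge> - r (- y) \<ge> - p (- y)\<close>.\<close>
      define u where "u y = (INF q\<in>C. q y)" for y
      have lower: "u y \<le> q y" if "q \<in> C" for q y
        unfolding u_def
      proof (rule cINF_lower)
        show "bdd_below ((\<lambda>q. q y) ` C)"
        proof (rule bdd_belowI2)
          fix r assume "r \<in> C"
          with CA have "sublinear r" "r (- y) \<le> p (- y)" by (auto simp: A_def le_fun_def)
          then show "- p (- y) \<le> r y" using sublinear_minus[of r y] by simp
        qed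
      qed (use that in simp)
      have greatest: "c \<le> u y" if "\<And>q. q \<in> C \<Longrightarrow> c \<le> q y" for c y
        unfolding u_def by (rule cINF_greatest) (use that False in auto)
      have sub: "sublinear q" if "q \<in> C" for q using that CA by (auto simp: A_def)
      have "sublinear u"
        unfolding sublinear_def
      proof (intro conjI allI impI)
        fix x y
        have *: "u (x + y) \<le> q x + r y" if "q \<in> C" "r \<in> C" for q r
        proof -
          \<comment> \<open>The smaller of \<open>q\<close> and \<open>r\<close> serves both
            summands; this is where the chain property enters.\<close>
          obtain s where s: "s \<in> C" "s \<le> q" "s \<le> r" using tot[OF \<open>q \<in> C\<close> \<open>r \<in> C\<close>] \<open>q \<in> C\<close> \<open>r \<in> C\<close> by blast
          have "u (x + y) \<le> s x + s y"
            using lower[OF s(1), of "x + y"] sublinear_add[OF sub[OF s(1)], of x y] by simp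
          also have "\<dots> \<le> q x + r y" using s by (intro add_mono) (auto simp: le_fun_def)
          finally show ?thesis .
        qed
        have "u (x + y) - q x \<le> u y" if "q \<in> C" for q
          by (rule greatest) (use *[OF that] in \<open>simp add: algebra_simps\<close>)
        then have "u (x + y) - u y \<le> u x"
          by (intro greatest) (simp add: algebra_simps)
        then show "u (x + y) \<le> u x + u y" by simp
      next
        fix c :: real and x assume c: "0 \<le> c"
        have *: "u (c *\<^sub>R x) \<le> c * q x" if "q \<in> C" for q
          using lower[OF that, of "c *\<^sub>R x"] sublinear_scaleR[OF sub[OF that] c, of x] by simp
        show "u (c *\<^sub>R x) \<le> c * u x"
        proof (cases "c = 0")
          case True
          \<comment> \<open>Here \<open>False\<close> still says that the chain is nonempty; any
            member gives the bound 0.\<close>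
          then show ?thesis using * False by fastforce
        next
          case False
          then have "u (c *\<^sub>R x) / c \<le> u x"
            using c * by (intro greatest) (simp add: field_simps)
          then show ?thesis using c False by (simp add: field_simps)
        qed
      qed
      moreover obtain q where "q \<in> C" using False by blast
      then have "u \<le> p" using lower[of q] CA by (auto simp: A_def le_fun_def intro: order_trans)
      ultimately show ?thesis using lower by (auto simp: A_def le_fun_def)
    qed
  qed
  then obtain m where m: "m \<in> A" and min: "\<And>a. a \<in> A \<Longrightarrow> a \<le> m \<Longrightarrow> a = m" by blast
  show thesis
  proof
    show "sublinear m" "m \<le> p" using m by (auto simp: A_def)
    show "r = m" if "sublinear r" "r \<le> m" for r
      using min[of r] that m by (auto simp: A_def)
  qed
qed

text \<open>Oddness, obtained from the tilts, turns subadditivity at \<open>- x\<close> and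
  \<open>- y\<close> into superadditivity at \<open>x\<close> and \<open>y\<close>, and carries
  homogeneity over to negative scalars.\<close>

lemma linear_minimal_sublinear:
  assumes q: "sublinear q" and min: "\<And>r. sublinear r \<Longrightarrow> r \<le> q \<Longrightarrow> r = q"
  shows "linear q"
proof -
  have neg: "q (- y) = - q y" for y
  proof -
    have "tilt q y = q"
      using sublinear_tilt[OF q] tilt_le_self[OF q] by (intro min) (auto simp: le_fun_def)
    then have "q (- y) \<le> - q y" using tilt_minus_le[OF q, of y] by simp
    with sublinear_minus[OF q, of y] show ?thesis by simp
  qed
  show ?thesis
  proof (rule linearI)
    fix x y
    have "q (- x + - y) \<le> q (- x) + q (- y)" by (rule sublinear_add[OF q])
    moreover have "- x + - y = - (x + y)" by simp
    ultimately have "q x + q y \<le> q (x + y)" by (simp only: neg)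
    then show "q (x + y) = q x + q y" using sublinear_add[OF q, of x y] by simp
  next
    fix c :: real and x
    show "q (c *\<^sub>R x) = c *\<^sub>R q x"
    proof (cases "0 \<le> c")
      case True
      then show ?thesis using sublinear_scaleR[OF q] by simp
    next
      case False
      then have "q (- ((- c) *\<^sub>R x)) = - ((- c) * q x)"
        using sublinear_scaleR[OF q, of "- c" x] neg by simp
      then show ?thesis by simp
    qed
  qed
qed

text \<open>The minimal functional is sought below \<open>tilt norm x\<close> instead of
  \<open>norm\<close>: this forces \<open>q (- x) \<le> - norm x\<close>, hence
  \<open>q x \<noteq> 0\<close>. Boundedness follows from \<open>q \<le> norm\<close> at
  \<open>y\<close> and \<open>- y\<close>.\<close>

lemma exists_bounded_linear_nonzero:
  fixes x :: "'a::real_normed_vector"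
  assumes "x \<noteq> 0"
  obtains u :: "'a \<Rightarrow> real" where "bounded_linear u" "u x \<noteq> 0"
proof -
  obtain q where q: "sublinear q" "q \<le> tilt norm x"
    and min: "\<And>r. sublinear r \<Longrightarrow> r \<le> q \<Longrightarrow> r = q"
    using exists_minimal_sublinear[OF sublinear_tilt[OF sublinear_norm]] by blast
  have lin: "linear q" by (rule linear_minimal_sublinear[OF q(1) min])
  have le: "q y \<le> norm y" for y
    using q(2) tilt_le_self[OF sublinear_norm, of x y] by (auto simp: le_fun_def intro: order_trans)
  have "norm (q y) \<le> norm y" for y
    using le[of y] le[of "- y"] linear_neg[OF lin, of y] by simp
  with lin have "bounded_linear q"
    by (intro bounded_linear_intro[where K = 1]) (simp_all add: linear_add linear_scale)
  moreover have "q (- x) \<le> - norm x"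
    using q(2) tilt_minus_le[OF sublinear_norm, of x] by (auto simp: le_fun_def intro: order_trans)
  then have "q x \<noteq> 0" using linear_neg[OF lin, of x] assms by auto
  ultimately show thesis by (rule that)
qed

section \<open>From real to complex functionals\<close>

lemma scaleC_Re_Im:
  fixes x :: "'a::complex_banach"
  shows "a *\<^sub>C x = Re a *\<^sub>R x + Im a *\<^sub>R (\<i> *\<^sub>C x)"
  by (simp add: scaleR_scaleC scaleC_scaleC flip: scaleC_add_left)
    (metis complex_eq mult.commute)

lemma exists_complex_functional_nonzero:
  fixes x :: "'a::complex_banach"
  assumes "x \<noteq> 0"
  obtains \<phi> :: "'a \<Rightarrow> complex"
  where "bounded_linear \<phi>" "\<And>a y. \<phi> (a *\<^sub>C y) = a * \<phi> y" "\<phi> x \<noteq> 0"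
proof -
  obtain u :: "'a \<Rightarrow> real" where u: "bounded_linear u" "u x \<noteq> 0"
    using exists_bounded_linear_nonzero[OF assms] .
  interpret u: bounded_linear u by fact
  \<comment> \<open>The usual complexification: the complex-linear functional whose real part is
    \<open>u\<close>, so that it inherits nonvanishing at \<open>x\<close>.\<close>
  define \<phi> where "\<phi> y = of_real (u y) - \<i> * of_real (u (\<i> *\<^sub>C y))" for y
  show thesis
  proof
    show "bounded_linear \<phi>"
      unfolding \<phi>_def
      by (intro bounded_linear_sub bounded_linear_const_mult
          bounded_linear_compose[OF bounded_linear_of_real] u(1)
          bounded_linear_compose[OF u(1) bounded_linear_scaleC])
    have ii: "\<i> *\<^sub>C \<i> *\<^sub>C y = - y" for y :: 'a
      using scaleR_scaleC[of "-1" y] by (simp add: scaleC_scaleC)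
    show "\<phi> (a *\<^sub>C y) = a * \<phi> y" for a y
    proof -
      have "\<i> *\<^sub>C a *\<^sub>C y = Re a *\<^sub>R (\<i> *\<^sub>C y) - Im a *\<^sub>R y"
        using scaleC_Re_Im[of a "\<i> *\<^sub>C y"]
        by (metis diff_conv_add_uminus ii mult.commute scaleC_scaleC scaleR_minus_right)
      then have "u (\<i> *\<^sub>C a *\<^sub>C y) = Re a * u (\<i> *\<^sub>C y) - Im a * u y"
        by (simp only: u.diff u.scaleR) simp
      moreover have "u (a *\<^sub>C y) = Re a * u y + Im a * u (\<i> *\<^sub>C y)"
        by (subst scaleC_Re_Im) (simp add: u.add u.scaleR)
      ultimately show ?thesis
        by (simp add: \<phi>_def complex_eq_iff)
    qed
    show "\<phi> x \<noteq> 0" using u(2) by (simp add: \<phi>_def complex_eq_iff)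
  qed
qed

section \<open>The sector\<close>

text \<open>The logarithm straightens the sector to a convex strip, from which openness,
  connectedness and arcs are transported by \<open>exp\<close>. For \<open>\<theta> > pi\<close> the
  strip covers the punctured plane more than once.\<close>

lemma sector_eq_exp_strip: "sector \<theta> = exp ` {\<zeta>. \<bar>Im \<zeta>\<bar> < \<theta>}"
proof (intro equalityI subsetI)
  fix z assume z: "z \<in> sector \<theta>"
  then have "z = exp (Ln z)" "\<bar>Im (Ln z)\<bar> < \<theta>"
    by (auto simp: sector_def Arg_eq_Im_Ln)
  then show "z \<in> exp ` {\<zeta>. \<bar>Im \<zeta>\<bar> < \<theta>}" by blast
next
  fix z assume "z \<in> exp ` {\<zeta>. \<bar>Im \<zeta>\<bar> < \<theta>}"
  then obtain \<zeta> where \<zeta>: "z = exp \<zeta>" "\<bar>Im \<zeta>\<bar> < \<theta>" by auto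
  have "\<bar>Arg (exp \<zeta>)\<bar> \<le> \<bar>Im \<zeta>\<bar>"
  proof (cases "- pi < Im \<zeta> \<and> Im \<zeta> \<le> pi")
    case True
    then show ?thesis by (simp add: Arg_exp)
  next
    case False
    \<comment> \<open>Outside the principal range \<open>\<bar>Im \<zeta>\<bar>\<close> is at least
      \<open>pi\<close>, which bounds every argument.\<close>
    then show ?thesis using Arg_bounded[of "exp \<zeta>"] by linarith
  qed
  with \<zeta> show "z \<in> sector \<theta>" by (simp add: sector_def)
qed

lemma strip_open_convex:
  shows open_strip: "open {\<zeta>. \<bar>Im \<zeta>\<bar> < \<theta>}" and convex_strip: "convex {\<zeta>. \<bar>Im \<zeta>\<bar> < \<theta>}"
proof -
  have *: "{\<zeta>. \<bar>Im \<zeta>\<bar> < \<theta>} = {\<zeta>. Im \<zeta> < \<theta>} \<inter> {\<zeta>. Im \<zeta> > - \<theta>}" by auto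
  show "open {\<zeta>. \<bar>Im \<zeta>\<bar> < \<theta>}"
    unfolding * by (intro open_Int open_halfspace_Im_lt open_halfspace_Im_gt)
  show "convex {\<zeta>. \<bar>Im \<zeta>\<bar> < \<theta>}"
    unfolding * by (intro convex_Int convex_halfspace_Im_lt convex_halfspace_Im_gt)
qed

text \<open>Open mapping theorem: \<open>exp\<close> is constant on no nonempty open set, as its
  derivative never vanishes.\<close>

lemma open_sector: "open (sector \<theta>)"
  unfolding sector_eq_exp_strip
proof (rule open_mapping_thm2[of exp UNIV])
  show "\<not> exp constant_on X" if "open X" "X \<noteq> {}" for X :: "complex set"
  proof
    assume "exp constant_on X"
    then obtain c where c: "\<And>w. w \<in> X \<Longrightarrow> exp w = c" by (auto simp: constant_on_def)
    obtain w where w: "w \<in> X" using \<open>X \<noteq> {}\<close> by blast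
    have "(exp has_field_derivative 0) (at w)"
      by (rule has_field_derivative_transform_within_open[of "\<lambda>_. c" _ _ X])
        (use that w c in auto)
    then have "exp w = 0" using DERIV_unique DERIV_exp by blast
    then show False by simp
  qed
qed (auto intro: holomorphic_intros simp: open_strip)

lemma connected_sector: "connected (sector \<theta>)"
  unfolding sector_eq_exp_strip
  by (intro connected_continuous_image convex_connected convex_strip continuous_intros)

lemma of_real_in_sector: "0 < \<theta> \<Longrightarrow> 0 < t \<Longrightarrow> of_real t \<in> sector \<theta>"
  by (simp add: sector_def)

text \<open>Since \<open>Re (Ln z) = ln (cmod z)\<close>, the segment \<open>?l\<close> is vertical
  and its exponential is a circular arc from the positive real axis to \<open>z\<close>.\<close>

lemma sector_arc:
  assumes z: "z \<in> sector \<theta>" and \<theta>: "0 < \<theta>"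
  obtains C where "compact C" "connected C" "C \<subseteq> sector \<theta>" "z \<in> C" "of_real (cmod z) \<in> C"
proof
  let ?l = "closed_segment (of_real (ln (cmod z))) (Ln z)"
  have z0: "z \<noteq> 0" using z by (simp add: sector_def)
  show "compact (exp ` ?l)" "connected (exp ` ?l)"
    by (intro compact_continuous_image connected_continuous_image continuous_intros; simp)+
  have "?l \<subseteq> {\<zeta>. \<bar>Im \<zeta>\<bar> < \<theta>}"
    using z \<theta> by (intro closed_segment_subset convex_strip) (auto simp: sector_def Arg_eq_Im_Ln)
  then show "exp ` ?l \<subseteq> sector \<theta>" unfolding sector_eq_exp_strip by (rule image_mono)
  show "z \<in> exp ` ?l" using z0 by (intro image_eqI[of _ _ "Ln z"]) auto
  show "of_real (cmod z) \<in> exp ` ?l"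
    using z0 by (intro image_eqI[of _ _ "of_real (ln (cmod z))"]) (auto simp: exp_of_real)
qed

section \<open>Injectivity\<close>

text \<open>Reduces operator-valued analyticity to scalar functions, for which the identity theorem
  is available: \<open>L\<close> commutes with complex scalars, so the derivative becomes
  multiplication by \<open>L f'\<close>.\<close>

lemma holomorphic_on_functional:
  assumes f: "banach_analytic_on f S" and L: "bounded_linear L"
    and LC: "\<And>a y. L (a *\<^sub>C y) = a * L y"
  shows "(\<lambda>w. L (f w)) holomorphic_on S"
proof (rule holomorphic_onI)
  fix w assume "w \<in> S"
  with f obtain f' where "(f has_derivative (\<lambda>h. h *\<^sub>C f')) (at w)"
    unfolding banach_analytic_on_def by (meson centre_in_ball)
  then have "((\<lambda>w. L (f w)) has_derivative (\<lambda>h. L (h *\<^sub>C f'))) (at w)"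
    by (rule bounded_linear.has_derivative[OF L])
  then have "((\<lambda>w. L (f w)) has_field_derivative L f') (at w)"
    by (simp add: has_field_derivative_def LC mult.commute[of _ "L f'"])
  then show "(\<lambda>w. L (f w)) field_differentiable at w within S"
    by (metis field_differentiable_at_within field_differentiable_def)
qed

text \<open>Supplies the accumulation point for the identity theorem on a set where the semigroup
  law is known; the nearby points are \<open>r + h\<close> with small \<open>h > 0\<close>.\<close>

lemma islimpt_of_real_pos:
  assumes "open U" "of_real r \<in> U" "0 < r"
  shows "(of_real r :: complex) islimpt {w \<in> U. \<exists>s>0. w = of_real s}"
  unfolding islimpt_approachable
proof (intro allI impI)
  fix e :: real assume e: "0 < e"
  obtain d where d: "0 < d" "ball (of_real r) d \<subseteq> U" using assms open_contains_ball by blast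
  define h where "h = min e d / 2"
  have h: "0 < h" "h < e" "h < d" using e d by (auto simp: h_def)
  have "of_real (r + h) \<in> U" using d(2) h by (auto simp: dist_norm subset_iff)
  moreover have "0 < r + h" using assms h by simp
  ultimately show "\<exists>x'\<in>{w \<in> U. \<exists>s>0. w = of_real s}. x' \<noteq> of_real r \<and> dist x' (of_real r :: complex) < e"
    using h by (intro bexI[of _ "of_real (r + h)"]) (auto simp: dist_norm intro!: exI[of _ "r + h"])
qed

theorem proposition5:
  fixes T :: "real \<Rightarrow> ('a::complex_banach \<Rightarrow>\<^sub>L 'a)"
    and A :: "'a \<Rightarrow> 'a" and D :: "'a set"
    and E :: "complex \<Rightarrow> ('a \<Rightarrow>\<^sub>L 'a)"
    and M \<omega> \<theta> :: real
  assumes "C0_semigroup T"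
    and "semigroup_of_type M \<omega> T"
    and "is_generator D A T"
    and "\<theta> > 0"
    and "analytic_extension \<theta> T E"
  shows "\<forall>z\<in>sector \<theta>. inj (blinfun_apply (E z))"
proof
  fix z assume z: "z \<in> sector \<theta>"
  let ?S = "sector \<theta>"
  have an: "banach_analytic_on E ?S" and ET: "\<And>t. 0 < t \<Longrightarrow> E (of_real t) = T t"
    using assms(5) by (auto simp: analytic_extension_def)
  have Tlin: "\<And>t a x. 0 \<le> t \<Longrightarrow> blinfun_apply (T t) (a *\<^sub>C x) = a *\<^sub>C blinfun_apply (T t) x"
    and Tadd: "\<And>s t. 0 \<le> s \<Longrightarrow> 0 \<le> t \<Longrightarrow> T (s + t) = T s o\<^sub>L T t"
    and Tlim: "\<And>x. ((\<lambda>t. blinfun_apply (T t) x) \<longlongrightarrow> x) (at_right 0)"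
    using assms(1) by (auto simp: C0_semigroup_def complex_linear_def)
  have "x = 0" if x: "blinfun_apply (E z) x = 0" for x
  proof (rule ccontr)
    assume "x \<noteq> 0"
    then obtain \<phi> :: "'a \<Rightarrow> complex"
      where \<phi>: "bounded_linear \<phi>" "\<And>a y. \<phi> (a *\<^sub>C y) = a * \<phi> y" "\<phi> x \<noteq> 0"
      by (rule exists_complex_functional_nonzero) blast
    define g where "g w = \<phi> (blinfun_apply (E w) x)" for w
    have hol: "g holomorphic_on ?S"
      unfolding g_def
      by (rule holomorphic_on_functional[OF an, where L = "\<lambda>F. \<phi> (blinfun_apply F x)"])
        (auto intro: bounded_linear_compose[OF \<phi>(1)] bounded_linear_intros
          simp: scaleC_blinfun.rep_eq \<phi>(2))
    obtain C where C: "compact C" "connected C" "C \<subseteq> ?S" "z \<in> C" "of_real (cmod z) \<in> C"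
      using sector_arc[OF z assms(4)] .
    \<comment> \<open>Compactness of the arc gives one radius \<open>e\<close> for all its points,
      so shifts by \<open>t < e\<close> keep the whole arc in the sector.\<close>
    obtain e where e: "e > 0" "(\<Union>w\<in>C. ball w e) \<subseteq> ?S"
      using compact_subset_open_imp_ball_epsilon_subset[OF C(1) open_sector C(3)] .
    have shift: "g (z + of_real t) = 0" if t: "0 < t" "t < e" for t
    proof -
      define V where "V = ?S \<inter> (\<lambda>w. w + of_real t) -` ?S"
      \<comment> \<open>Passing to the component of \<open>z\<close> avoids any discussion of the
        connectedness of \<open>V\<close>; it contains the arc, hence the positive real
        \<open>cmod z\<close>.\<close>
      define U where "U = connected_component_set V z"
      \<comment> \<open>The defect in the law \<open>E (w + t) = T t o\<^sub>L E w\<close>, tested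
        on \<open>x\<close> with \<open>\<phi>\<close>.\<close>
      define h where "h w = g (w + of_real t) - \<phi> (blinfun_apply (T t) (blinfun_apply (E w) x))" for w
      have "open V" unfolding V_def
        by (intro open_Int open_sector open_vimage continuous_intros)
      then have oU: "open U" unfolding U_def by (rule open_connected_component)
      have UV: "U \<subseteq> V" unfolding U_def by (rule connected_component_subset)
      have "w + of_real t \<in> ball w e" for w :: complex using t by (simp add: dist_norm)
      then have "w + of_real t \<in> ?S" if "w \<in> C" for w using e(2) that by blast
      then have "C \<subseteq> V" using C(3) by (auto simp: V_def)
      then have CU: "C \<subseteq> U" unfolding U_def using C by (intro connected_component_maximal) auto
      have r: "0 < cmod z" using z by (auto simp: sector_def)
      have "(g \<circ> (\<lambda>w. w + of_real t)) holomorphic_on V"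
        by (rule holomorphic_on_compose_gen[OF _ hol])
          (auto intro!: holomorphic_intros simp: V_def)
      \<comment> \<open>The type of \<open>T t\<close> gives only real linearity;
        \<open>Tlin\<close> supplies the complex homogeneity of this functional.\<close>
      moreover have "(\<lambda>w. \<phi> (blinfun_apply (T t) (blinfun_apply (E w) x))) holomorphic_on ?S"
        by (rule holomorphic_on_functional[OF an,
              where L = "\<lambda>F. \<phi> (blinfun_apply (T t) (blinfun_apply F x))"])
          (use t in \<open>auto intro!: bounded_linear_compose[OF \<phi>(1)]
              bounded_linear_compose[OF blinfun.bounded_linear_right] bounded_linear_intros
            simp: scaleC_blinfun.rep_eq \<phi>(2) Tlin\<close>)
      ultimately have "h holomorphic_on U"
        unfolding h_def o_def using UV
        by (intro holomorphic_on_diff) (auto simp: V_def elim: holomorphic_on_subset)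
      then have "h z = 0"
      proof (rule analytic_continuation[where U = "{w \<in> U. \<exists>s>0. w = of_real s}"
            and \<xi> = "of_real (cmod z)"])
        show "open U" by fact
        show "connected U" unfolding U_def by simp
        show "of_real (cmod z) islimpt {w \<in> U. \<exists>s>0. w = of_real s}"
          using oU CU C(5) r by (intro islimpt_of_real_pos) auto
        show "h w = 0" if "w \<in> {w \<in> U. \<exists>s>0. w = of_real s}" for w
        proof -
          obtain s where s: "0 < s" "w = of_real s" using \<open>w \<in> _\<close> by auto
          \<comment> \<open>On the positive reals \<open>E\<close> is the semigroup, so the law is
            \<open>Tadd\<close>.\<close>
          then have "E (w + of_real t) = T t o\<^sub>L E w"
            using ET[of "s + t"] ET[of s] Tadd[of t s] t by (simp add: add.commute)
          then show ?thesis by (simp add: h_def g_def)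
        qed
      qed (use CU C in auto)
      \<comment> \<open>At \<open>z\<close> the second term of \<open>h\<close> vanishes because
        \<open>E z\<close> annihilates \<open>x\<close>.\<close>
      then show ?thesis
        using bounded_linear.linear[OF \<phi>(1)] by (simp add: h_def x linear_0 blinfun.zero_right)
    qed
    have g0: "g w = 0" if w: "w \<in> ?S" for w
    \<comment> \<open>Second continuation: the zeros \<open>z + t\<close> accumulate at
      \<open>z\<close>, an interior point of the connected sector.\<close>
    proof (rule analytic_continuation[OF hol open_sector connected_sector,
          where U = "{z + of_real t |t. 0 < t \<and> t < e}" and \<xi> = z])
      show "z islimpt {z + of_real t |t. 0 < t \<and> t < e}"
        unfolding islimpt_approachable
      proof (intro allI impI)
        fix d :: real assume "0 < d"
        then show "\<exists>w\<in>{z + of_real t |t. 0 < t \<and> t < e}. w \<noteq> z \<and> dist w z < d"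
          using e(1)
          by (intro bexI[of _ "z + of_real (min d e / 2)"])
            (auto simp: dist_norm intro!: exI[of _ "min d e / 2"])
      qed
      show "{z + of_real t |t. 0 < t \<and> t < e} \<subseteq> ?S"
        using e(2) C(4) by (force simp: dist_norm)
    qed (use z w shift in auto)
    have "((\<lambda>t. \<phi> (blinfun_apply (T t) x)) \<longlongrightarrow> \<phi> x) (at_right 0)"
      by (rule bounded_linear.tendsto[OF \<phi>(1) Tlim])
    moreover have "eventually (\<lambda>t. \<phi> (blinfun_apply (T t) x) = 0) (at_right 0)"
      using eventually_at_right_less[of "0::real"]
    proof (rule eventually_mono)
      fix t :: real assume "0 < t"
      then show "\<phi> (blinfun_apply (T t) x) = 0"
        using g0[OF of_real_in_sector[OF assms(4)], of t] ET[of t] by (simp add: g_def)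
    qed
    \<comment> \<open>Strong continuity at 0 makes \<open>\<phi> x\<close> the limit of the zero
      function.\<close>
    ultimately have "((\<lambda>t. 0) \<longlongrightarrow> \<phi> x) (at_right (0::real))"
      by (rule Lim_transform_eventually)
    then have "\<phi> x = 0" by (simp add: tendsto_const_iff)
    with \<phi>(3) show False by simp
  qed
  then show "inj (blinfun_apply (E z))"
    using linear_injective_0[OF bounded_linear.linear[OF blinfun.bounded_linear_right]] by blast
qed

end
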